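(* For $0<\alpha\le\frac12$, $$\frac{\Gamma^2(\alpha)\,\Gamma(2\alpha+4)}{6\,\Gamma(1+2\alpha)}\ \ge\ \Vert\tilde G_\alpha\Vert^{-1}\ \ge\ \frac{\Gamma(1+\alpha)\,\Gamma(1-\alpha)}{\Gamma(1-2\alpha)},$$ where $\tilde G_\alpha$ is the integral operator on $L^2(0,1)$ with kernel $G_\alpha$ and $\Vert\cdot\Vert$ is the operator norm.
   Context: For $0<\alpha\le\frac12$ and $(x,y)\in[0,1]^2$ with $x\ne y$, $$G_\alpha(x,y)=\frac{1}{\Gamma^2(\alpha)}x^\alpha y^\alpha\int_{\max(x,y)}^1\frac{(t-x)^{\alpha-1}(t-y)^{\alpha-1}}{t^{2\alpha}}\,dt .$$ Here $\Gamma$ is Euler's Gamma function, and for $\alpha=\frac12$ the quantity $1/\Gamma(1-2\alpha)=1/\Gamma(0)$ is read as $0$. *)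

theory Defs
  imports "HOL-Analysis.Analysis"
begin

(* On the diagonal x = y the integral diverges for \<alpha> \<le> 1/2, and the expression below is then 0 by the
   convention for non-integrable functions; the diagonal is a null set, so the integral operator
   does not see this value. *)
definition G_kernel :: "real \<Rightarrow> real \<Rightarrow> real \<Rightarrow> real" where
  "G_kernel \<alpha> x y =
     1 / (Gamma \<alpha>)\<^sup>2 * x powr \<alpha> * y powr \<alpha> *
     (LBINT t:{max x y..1}. (t - x) powr (\<alpha> - 1) * (t - y) powr (\<alpha> - 1) / t powr (2 * \<alpha>))"

(* Elements of L^2 are represented by square-integrable functions; L2_norm is a seminorm on these,
   vanishing exactly on the null functions, so norm and operator norm agree with those of the
   quotient space. *)
definition L2_space :: "'a measure \<Rightarrow> ('a \<Rightarrow> real) set" where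
  "L2_space M = {f. f \<in> borel_measurable M \<and> integrable M (\<lambda>x. (f x)\<^sup>2)}"

definition L2_norm :: "'a measure \<Rightarrow> ('a \<Rightarrow> real) \<Rightarrow> real" where
  "L2_norm M f = sqrt (\<integral>x. (f x)\<^sup>2 \<partial>M)"

definition integral_operator ::
    "'a measure \<Rightarrow> ('a \<Rightarrow> 'a \<Rightarrow> real) \<Rightarrow> ('a \<Rightarrow> real) \<Rightarrow> 'a \<Rightarrow> real" where
  "integral_operator M K f x = (\<integral>y. K x y * f y \<partial>M)"

(* The almost-everywhere clause excludes that values of integral_operator come from the default
   value of the integral; it also makes the operator linear on L^2. *)
definition bounded_L2_integral_operator :: "'a measure \<Rightarrow> ('a \<Rightarrow> 'a \<Rightarrow> real) \<Rightarrow> bool" where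
  "bounded_L2_integral_operator M K \<longleftrightarrow>
     (\<forall>f\<in>L2_space M. (AE x in M. integrable M (\<lambda>y. K x y * f y))
        \<and> integral_operator M K f \<in> L2_space M) \<and>
     (\<exists>C. \<forall>f\<in>L2_space M. L2_norm M (integral_operator M K f) \<le> C * L2_norm M f)"

(* A real supremum: meaningful only if the operator is bounded on L^2. *)
definition L2_opnorm :: "'a measure \<Rightarrow> (('a \<Rightarrow> real) \<Rightarrow> 'a \<Rightarrow> real) \<Rightarrow> real" where
  "L2_opnorm M T = Sup {L2_norm M (T f) | f. f \<in> L2_space M \<and> L2_norm M f \<le> 1}"

(* Borel representatives suffice: every Lebesgue measurable function is a.e. equal to a Borel one. *)
abbreviation unit_interval_measure :: "real measure" where
  "unit_interval_measure \<equiv> restrict_space lborel {0<..<1}"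

abbreviation G_operator :: "real \<Rightarrow> (real \<Rightarrow> real) \<Rightarrow> real \<Rightarrow> real" where
  "G_operator \<alpha> \<equiv> integral_operator unit_interval_measure (G_kernel \<alpha>)"

end

(* Interchanging the integrations turns int_0^1 G(x,y) dy into two successive Beta integrals, and
   this gives (G 1)(x) = (x (1 - x))^\<alpha> / Gamma (1 + 2 \<alpha>) for the constant function 1.
   Since G is symmetric and nonnegative, Schur's test with the constant weight bounds the norm by
   1 / Gamma (1 + 2 \<alpha>), and this is enough because Gamma (1 + a) Gamma (1 - a) increases in a on [0,1)
   by log-convexity. In the other direction the norm is at least the L2 norm of G 1, which is
   1 / sqrt (Gamma (4 \<alpha> + 2)) by a further Beta integral; crude bounds on Gamma then suffice. *)
theory Submission
  imports Defs
begin

section \<open>Schur's test with constant weight\<close>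

text \<open>Cauchy-Schwarz for the splitting K |f| = sqrt K * (sqrt K |f|), with the row bound,
  gives (int K |f|)^2 \<le> C int K f^2 pointwise in x. Integrating in x, exchanging the integrals
  and using the column bound gives the factor C^2. Working with nonnegative integrals throughout
  makes integrability of almost every row a consequence instead of a prerequisite.\<close>

lemma schur_test:
  fixes K :: "'a \<Rightarrow> 'a \<Rightarrow> real"
  assumes "sigma_finite_measure M"
    and K [measurable]: "case_prod K \<in> borel_measurable (M \<Otimes>\<^sub>M M)"
    and nonneg: "\<And>x y. 0 \<le> K x y" and C: "0 \<le> C"
    and row: "\<And>x. x \<in> space M \<Longrightarrow> (\<integral>\<^sup>+y. ennreal (K x y) \<partial>M) \<le> ennreal C"
    and column: "\<And>y. y \<in> space M \<Longrightarrow> (\<integral>\<^sup>+x. ennreal (K x y) \<partial>M) \<le> ennreal C"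
    and f: "f \<in> L2_space M"
  shows "AE x in M. integrable M (\<lambda>y. K x y * f y)"
    and "integral_operator M K f \<in> L2_space M"
    and "L2_norm M (integral_operator M K f) \<le> C * L2_norm M f"
proof -
  interpret sigma_finite_measure M by fact
  interpret pair_sigma_finite M M by unfold_locales
  have fm [measurable]: "f \<in> borel_measurable M" and fi: "integrable M (\<lambda>x. (f x)\<^sup>2)"
    using f by (auto simp: L2_space_def)
  \<comment> \<open>\<open>F\<close> dominates the absolute value of the operator's output; it is
    defined everywhere, possibly with value infinity.\<close>
  define F where "F x = (\<integral>\<^sup>+y. ennreal (K x y * \<bar>f y\<bar>) \<partial>M)" for x
  have [measurable]: "F \<in> borel_measurable M" unfolding F_def by measurable
  have Tm [measurable]: "integral_operator M K f \<in> borel_measurable M"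
    unfolding integral_operator_def by measurable
  have F_le: "(F x)\<^sup>2 \<le> ennreal C * (\<integral>\<^sup>+y. ennreal (K x y * (f y)\<^sup>2) \<partial>M)" if x: "x \<in> space M" for x
  proof -
    have [measurable]: "K x \<in> borel_measurable M"
      using measurable_Pair2[OF K x] by simp
    have F_eq: "F x = (\<integral>\<^sup>+y. ennreal (sqrt (K x y)) * ennreal (sqrt (K x y) * \<bar>f y\<bar>) \<partial>M)"
      unfolding F_def
      by (intro nn_integral_cong) (simp add: nonneg ennreal_mult[symmetric] mult.assoc[symmetric])
    have "(F x)\<^sup>2 \<le> (\<integral>\<^sup>+y. (ennreal (sqrt (K x y)))\<^sup>2 \<partial>M)
        * (\<integral>\<^sup>+y. (ennreal (sqrt (K x y) * \<bar>f y\<bar>))\<^sup>2 \<partial>M)"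
      unfolding F_eq by (intro Cauchy_Schwarz_nn_integral) measurable
    also have "\<dots> = (\<integral>\<^sup>+y. ennreal (K x y) \<partial>M) * (\<integral>\<^sup>+y. ennreal (K x y * (f y)\<^sup>2) \<partial>M)"
      by (simp add: ennreal_power nonneg power_mult_distrib)
    also have "\<dots> \<le> ennreal C * (\<integral>\<^sup>+y. ennreal (K x y * (f y)\<^sup>2) \<partial>M)"
      by (intro mult_right_mono row x) simp
    finally show ?thesis .
  qed
  have "(\<integral>\<^sup>+x. (F x)\<^sup>2 \<partial>M) \<le> (\<integral>\<^sup>+x. ennreal C * (\<integral>\<^sup>+y. ennreal (K x y * (f y)\<^sup>2) \<partial>M) \<partial>M)"
    by (intro nn_integral_mono F_le)
  also have "\<dots> = ennreal C * (\<integral>\<^sup>+x. (\<integral>\<^sup>+y. ennreal (K x y * (f y)\<^sup>2) \<partial>M) \<partial>M)"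
    by (intro nn_integral_cmult) measurable
  also have "(\<integral>\<^sup>+x. (\<integral>\<^sup>+y. ennreal (K x y * (f y)\<^sup>2) \<partial>M) \<partial>M)
      = (\<integral>\<^sup>+y. (\<integral>\<^sup>+x. ennreal (K x y * (f y)\<^sup>2) \<partial>M) \<partial>M)"
    by (rule Fubini'[symmetric]) measurable
  also have "\<dots> = (\<integral>\<^sup>+y. (\<integral>\<^sup>+x. ennreal (K x y) \<partial>M) * ennreal ((f y)\<^sup>2) \<partial>M)"
  proof (intro nn_integral_cong)
    fix y assume y: "y \<in> space M"
    have [measurable]: "(\<lambda>x. K x y) \<in> borel_measurable M"
      using measurable_Pair1[OF K y] by simp
    show "(\<integral>\<^sup>+x. ennreal (K x y * (f y)\<^sup>2) \<partial>M) = (\<integral>\<^sup>+x. ennreal (K x y) \<partial>M) * ennreal ((f y)\<^sup>2)"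
      by (simp add: ennreal_mult nonneg nn_integral_multc)
  qed
  also have "\<dots> \<le> (\<integral>\<^sup>+y. ennreal C * ennreal ((f y)\<^sup>2) \<partial>M)"
    by (intro nn_integral_mono mult_right_mono column) auto
  also have "\<dots> = ennreal C * (\<integral>\<^sup>+y. ennreal ((f y)\<^sup>2) \<partial>M)"
    by (rule nn_integral_cmult) measurable
  also have "(\<integral>\<^sup>+y. ennreal ((f y)\<^sup>2) \<partial>M) = ennreal (\<integral>y. (f y)\<^sup>2 \<partial>M)"
    by (intro nn_integral_eq_integral fi) auto
  finally have F2: "(\<integral>\<^sup>+x. (F x)\<^sup>2 \<partial>M) \<le> ennreal (C\<^sup>2 * (\<integral>y. (f y)\<^sup>2 \<partial>M))"
    using C by (simp add: mult_left_mono power2_eq_square mult.assoc flip: ennreal_mult)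
  have "AE x in M. (F x)\<^sup>2 \<noteq> \<infinity>"
    using F2 by (intro nn_integral_PInf_AE) (auto simp: top_unique)
  then show "AE x in M. integrable M (\<lambda>y. K x y * f y)"
  proof (rule AE_mp, intro AE_I2 impI)
    fix x assume x: "x \<in> space M" and "(F x)\<^sup>2 \<noteq> \<infinity>"
    then have "F x < \<infinity>" by (cases "F x = \<infinity>") (auto simp: less_top)
    moreover have [measurable]: "K x \<in> borel_measurable M"
      using measurable_Pair2[OF K x] by simp
    ultimately show "integrable M (\<lambda>y. K x y * f y)"
      by (intro integrableI_bounded) (auto simp: F_def abs_mult nonneg)
  qed
  \<comment> \<open>This holds for every x: where the row is not integrable, the Bochner integral
    has its default value 0.\<close>
  have T_le: "ennreal ((integral_operator M K f x)\<^sup>2) \<le> (F x)\<^sup>2" for x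
  proof -
    have "ennreal \<bar>integral_operator M K f x\<bar> \<le> F x"
    proof (cases "integrable M (\<lambda>y. K x y * f y)")
      case True
      from integral_norm_bound_ennreal[OF this] show ?thesis
        by (simp add: integral_operator_def F_def abs_mult nonneg)
    qed (simp add: integral_operator_def not_integrable_integral_eq)
    then have "(ennreal \<bar>integral_operator M K f x\<bar>)\<^sup>2 \<le> (F x)\<^sup>2"
      by (intro power_mono) auto
    then show ?thesis by (simp add: ennreal_power)
  qed
  have T2: "(\<integral>\<^sup>+x. ennreal ((integral_operator M K f x)\<^sup>2) \<partial>M) \<le> ennreal (C\<^sup>2 * (\<integral>y. (f y)\<^sup>2 \<partial>M))"
    by (rule order_trans[OF nn_integral_mono[OF T_le] F2])
  have Ti: "integrable M (\<lambda>x. (integral_operator M K f x)\<^sup>2)"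
    using T2 by (intro integrableI_bounded) (auto simp: less_top[symmetric] top_unique)
  then show "integral_operator M K f \<in> L2_space M" by (simp add: L2_space_def)
  have "(\<integral>x. (integral_operator M K f x)\<^sup>2 \<partial>M) \<le> C\<^sup>2 * (\<integral>y. (f y)\<^sup>2 \<partial>M)"
    using T2 C by (simp add: nn_integral_eq_integral[OF Ti])
  then have "L2_norm M (integral_operator M K f) \<le> sqrt (C\<^sup>2 * (\<integral>y. (f y)\<^sup>2 \<partial>M))"
    unfolding L2_norm_def by (rule real_sqrt_le_mono)
  then show "L2_norm M (integral_operator M K f) \<le> C * L2_norm M f"
    using C by (simp add: L2_norm_def real_sqrt_mult)
qed

section \<open>Scaled and shifted Beta integrals\<close>

text \<open>The substitution y = t s reduces to the Beta integral over [0,1]; the Jacobian and the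
  two factors contribute the powers 1, a - 1 and b - 1 of t.\<close>

lemma nn_integral_Beta_scaled:
  fixes a b t :: real
  assumes "0 < a" "0 < b" "0 < t"
  shows "(\<integral>\<^sup>+y. ennreal (indicator {0..t} y * (y powr (a - 1) * (t - y) powr (b - 1))) \<partial>lborel)
    = ennreal (t powr (a + b - 1) * Beta a b)"
proof -
  have "(\<integral>\<^sup>+y. ennreal (indicator {0..t} y * (y powr (a - 1) * (t - y) powr (b - 1))) \<partial>lborel)
    = ennreal \<bar>t\<bar> * (\<integral>\<^sup>+s. ennreal (indicator {0..t} (0 + t * s) * ((0 + t * s) powr (a - 1) * (t - (0 + t * s)) powr (b - 1))) \<partial>lborel)"
    using assms by (intro nn_integral_real_affine) auto
  also have "\<dots> = ennreal t * (\<integral>\<^sup>+s. ennreal (t powr (a + b - 2)) *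
      ennreal (indicator {0..1} s * (s powr (a - 1) * (1 - s) powr (b - 1))) \<partial>lborel)"
  proof -
    have "indicator {0..t} (0 + t * s) * ((0 + t * s) powr (a - 1) * (t - (0 + t * s)) powr (b - 1))
      = t powr (a + b - 2) * (indicator {0..1} s * (s powr (a - 1) * (1 - s) powr (b - 1)))" for s
    proof (cases "s \<in> {0..1}")
      case True
      have "(t * s) powr (a - 1) * (t * (1 - s)) powr (b - 1)
        = (t powr (a - 1) * t powr (b - 1)) * (s powr (a - 1) * (1 - s) powr (b - 1))"
        using True assms by (simp add: powr_mult)
      also have "t powr (a - 1) * t powr (b - 1) = t powr (a + b - 2)"
        by (simp add: powr_add[symmetric])
      finally show ?thesis using True assms
        by (simp add: indicator_def algebra_simps mult_le_cancel_left1)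
    next
      case False
      then show ?thesis using assms
        by (auto simp: indicator_def zero_le_mult_iff mult_le_cancel_left1)
    qed
    then show ?thesis using assms by (simp add: ennreal_mult)
  qed
  also have "\<dots> = ennreal t * (ennreal (t powr (a + b - 2)) * ennreal (Beta a b))"
  proof -
    have "(\<integral>\<^sup>+s. ennreal (indicator {0..1} s * (s powr (a - 1) * (1 - s) powr (b - 1))) \<partial>lborel)
      = ennreal (Beta a b)"
      using nn_integral_has_integral_lebesgue[OF _ has_integral_Beta_real[of a b]] assms
      by simp
    then show ?thesis by (simp add: nn_integral_cmult)
  qed
  also have "\<dots> = ennreal (t powr 1 * t powr (a + b - 2) * Beta a b)"
    using assms by (simp add: Beta_def mult.assoc flip: ennreal_mult)
  also have "t powr 1 * t powr (a + b - 2) = t powr (a + b - 1)"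
    by (simp only: powr_add[symmetric]) simp
  finally show ?thesis .
qed

text \<open>After the shift s = t - x this is the scaled Beta integral with b = 1, and Beta(a,1) =
  1/a.\<close>

lemma nn_integral_powr_shift:
  fixes a x c :: real
  assumes "0 < a" "x < c"
  shows "(\<integral>\<^sup>+t. ennreal (indicator {x..c} t * (t - x) powr (a - 1)) \<partial>lborel) = ennreal ((c - x) powr a / a)"
proof -
  have "(\<integral>\<^sup>+t. ennreal (indicator {x..c} t * (t - x) powr (a - 1)) \<partial>lborel)
    = ennreal \<bar>1\<bar> * (\<integral>\<^sup>+s. ennreal (indicator {x..c} (x + 1 * s) * (x + 1 * s - x) powr (a - 1)) \<partial>lborel)"
    by (intro nn_integral_real_affine) auto
  also have "\<dots> = (\<integral>\<^sup>+s. ennreal (indicator {0..c - x} s * (s powr (a - 1) * (c - x - s) powr (1 - 1))) \<partial>lborel)"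
  proof -
    \<comment> \<open>The artificial factor \<open>(c - x - s) powr (1 - 1)\<close> is 1 inside the
      interval but 0 at s = c - x, because \<open>0 powr 0 = 0\<close>; hence equality only almost
      everywhere.\<close>
    have "AE s in lborel. s \<noteq> c - x" by (rule AE_lborel_singleton)
    then have "(\<integral>\<^sup>+s. ennreal (indicator {x..c} (x + s) * s powr (a - 1)) \<partial>lborel)
      = (\<integral>\<^sup>+s. ennreal (indicator {0..c - x} s * (s powr (a - 1) * (c - x - s) powr (1 - 1))) \<partial>lborel)"
      by (intro nn_integral_cong_AE) (auto simp: indicator_def)
    then show ?thesis by simp
  qed
  also have "\<dots> = ennreal ((c - x) powr (a + 1 - 1) * Beta a 1)"
    using assms by (intro nn_integral_Beta_scaled) auto
  also have "Beta a 1 = 1 / a"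
  proof -
    have "a \<notin> \<int>\<^sub>\<le>\<^sub>0" using assms by auto
    then have "Gamma (a + 1) = a * Gamma a" by (rule Gamma_plus1)
    moreover have "0 < Gamma a" using assms by simp
    ultimately show ?thesis by (simp add: Beta_def)
  qed
  finally show ?thesis by simp
qed

section \<open>The integrand of the kernel, measurability and symmetry\<close>

text \<open>With the cutoff built into the integrand, the domain of the t-integral no longer depends
  on x and y, so that joint measurability and Fubini apply directly.\<close>

definition G_integrand :: "real \<Rightarrow> real \<Rightarrow> real \<Rightarrow> real \<Rightarrow> real" where
  "G_integrand \<alpha> x y t = indicator {max x y..1} t *
     ((t - x) powr (\<alpha> - 1) * (t - y) powr (\<alpha> - 1) / t powr (2 * \<alpha>))"

lemma G_integrand_measurable [measurable]:
  "(\<lambda>(x, y, t). G_integrand \<alpha> x y t) \<in> borel_measurable (borel \<Otimes>\<^sub>M borel \<Otimes>\<^sub>M borel)"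
proof -
  \<comment> \<open>The indicator of an interval with moving endpoints is rewritten as inequalities
    between the coordinates, whose measurability is automatic.\<close>
  have "(\<lambda>(x, y, t). G_integrand \<alpha> x y t) = (\<lambda>(x, y, t). if x \<le> t \<and> y \<le> t \<and> t \<le> 1
      then (t - x) powr (\<alpha> - 1) * (t - y) powr (\<alpha> - 1) / t powr (2 * \<alpha>) else 0)"
    by (auto simp: G_integrand_def indicator_def fun_eq_iff)
  also have "\<dots> \<in> borel_measurable (borel \<Otimes>\<^sub>M borel \<Otimes>\<^sub>M borel)"
    by measurable
  finally show ?thesis .
qed

lemma G_integrand_nonneg: "0 \<le> G_integrand \<alpha> x y t"
  by (simp add: G_integrand_def)

lemma G_kernel_eq:
  "G_kernel \<alpha> x y = 1 / (Gamma \<alpha>)\<^sup>2 * x powr \<alpha> * y powr \<alpha> * (\<integral>t. G_integrand \<alpha> x y t \<partial>lborel)"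
  by (simp add: G_kernel_def set_lebesgue_integral_def G_integrand_def)

lemma G_kernel_measurable [measurable]:
  "case_prod (G_kernel \<alpha>) \<in> borel_measurable (borel \<Otimes>\<^sub>M borel)"
proof -
  have *: "(\<lambda>((x, y), t). G_integrand \<alpha> x y t)
      \<in> borel_measurable ((borel \<Otimes>\<^sub>M borel) \<Otimes>\<^sub>M lborel)"
    using measurable_compose[of "\<lambda>((x, y), t). (x, y, t)" _ _ "\<lambda>(x, y, t). G_integrand \<alpha> x y t", OF _ G_integrand_measurable]
    by (simp add: case_prod_unfold)
  have "(\<lambda>p. \<integral>t. G_integrand \<alpha> (fst p) (snd p) t \<partial>lborel) \<in> borel_measurable (borel \<Otimes>\<^sub>M borel)"
    by (rule lborel.borel_measurable_lebesgue_integral) (use * in \<open>simp add: case_prod_unfold\<close>)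
  then show ?thesis
    unfolding G_kernel_eq case_prod_unfold by measurable
qed

lemma G_kernel_nonneg: "0 \<le> G_kernel \<alpha> x y"
  by (simp add: G_kernel_eq G_integrand_nonneg)

lemma G_kernel_commute: "G_kernel \<alpha> x y = G_kernel \<alpha> y x"
  by (simp add: G_kernel_def max.commute mult_ac)

section \<open>Row integrals of the kernel\<close>

text \<open>Integrating over y first gives \<open>t powr (2 * \<alpha>)\<close> times a Beta value,
  and this power cancels the denominator of the integrand. Only the integral of
  \<open>(t - x) powr (\<alpha> - 1)\<close> over [x,1] remains.\<close>

lemma nn_integral_G_integrand:
  assumes "0 < \<alpha>" "0 < x" "x < 1"
  shows "(\<integral>\<^sup>+y. (\<integral>\<^sup>+t. ennreal (indicator {0<..<1} y * y powr \<alpha> * G_integrand \<alpha> x y t) \<partial>lborel) \<partial>lborel)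
    = ennreal (Beta (\<alpha> + 1) \<alpha> * (1 - x) powr \<alpha> / \<alpha>)"
proof -
  have B: "0 \<le> Beta (\<alpha> + 1) \<alpha>" using assms by (simp add: Beta_def)
  have [measurable]: "(\<lambda>(y, t). G_integrand \<alpha> x y t) \<in> borel_measurable (borel \<Otimes>\<^sub>M borel)"
    using measurable_Pair2[OF G_integrand_measurable, of x] by simp
  have "(\<integral>\<^sup>+y. (\<integral>\<^sup>+t. ennreal (indicator {0<..<1} y * y powr \<alpha> * G_integrand \<alpha> x y t) \<partial>lborel) \<partial>lborel)
    = (\<integral>\<^sup>+t. (\<integral>\<^sup>+y. ennreal (indicator {0<..<1} y * y powr \<alpha> * G_integrand \<alpha> x y t) \<partial>lborel) \<partial>lborel)"
    by (rule lborel_pair.Fubini') measurable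
  also have "\<dots> = (\<integral>\<^sup>+t. ennreal (Beta (\<alpha> + 1) \<alpha>) * ennreal (indicator {x..1} t * (t - x) powr (\<alpha> - 1)) \<partial>lborel)"
  proof (intro nn_integral_cong)
    fix t :: real
    show "(\<integral>\<^sup>+y. ennreal (indicator {0<..<1} y * y powr \<alpha> * G_integrand \<alpha> x y t) \<partial>lborel)
      = ennreal (Beta (\<alpha> + 1) \<alpha>) * ennreal (indicator {x..1} t * (t - x) powr (\<alpha> - 1))"
    proof (cases "t \<in> {x..1}")
      case True
      then have t: "0 < t" "t \<le> 1" "x \<le> t" using assms by auto
      have "(\<integral>\<^sup>+y. ennreal (indicator {0<..<1} y * y powr \<alpha> * G_integrand \<alpha> x y t) \<partial>lborel)
        = (\<integral>\<^sup>+y. ennreal ((t - x) powr (\<alpha> - 1) / t powr (2 * \<alpha>)) *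
            ennreal (indicator {0..t} y * (y powr (\<alpha> + 1 - 1) * (t - y) powr (\<alpha> - 1))) \<partial>lborel)"
      proof (intro nn_integral_cong)
        fix y :: real
        have "indicator {0<..<1} y * y powr \<alpha> * G_integrand \<alpha> x y t
          = (t - x) powr (\<alpha> - 1) / t powr (2 * \<alpha>) *
              (indicator {0..t} y * (y powr (\<alpha> + 1 - 1) * (t - y) powr (\<alpha> - 1)))"
          \<comment> \<open>The indicators differ at y = 0, and at y = t when t = 1; there both
            sides vanish because \<open>0 powr p = 0\<close>.\<close>
          using t by (cases "y = 0 \<or> y = t") (auto simp: G_integrand_def indicator_def)
        then show "ennreal (indicator {0<..<1} y * y powr \<alpha> * G_integrand \<alpha> x y t)
          = ennreal ((t - x) powr (\<alpha> - 1) / t powr (2 * \<alpha>)) *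
            ennreal (indicator {0..t} y * (y powr (\<alpha> + 1 - 1) * (t - y) powr (\<alpha> - 1)))"
          by (simp only:) (rule ennreal_mult; simp)
      qed
      also have "\<dots> = ennreal ((t - x) powr (\<alpha> - 1) / t powr (2 * \<alpha>)) *
          ennreal (t powr (\<alpha> + 1 + \<alpha> - 1) * Beta (\<alpha> + 1) \<alpha>)"
        using assms t nn_integral_Beta_scaled[of "\<alpha> + 1" \<alpha> t] by (subst nn_integral_cmult) auto
      also have "\<dots> = ennreal (Beta (\<alpha> + 1) \<alpha>) * ennreal ((t - x) powr (\<alpha> - 1))"
        using t B by (simp add: mult.commute flip: ennreal_mult)
      finally show ?thesis using True by simp
    next
      case False
      then show ?thesis by (auto simp: G_integrand_def indicator_def)
    qed
  qed
  also have "\<dots> = ennreal (Beta (\<alpha> + 1) \<alpha>) * ennreal ((1 - x) powr \<alpha> / \<alpha>)"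
    using nn_integral_powr_shift[of \<alpha> x 1] assms by (subst nn_integral_cmult) auto
  also have "\<dots> = ennreal (Beta (\<alpha> + 1) \<alpha> * (1 - x) powr \<alpha> / \<alpha>)"
    using B assms by (simp flip: ennreal_mult)
  finally show ?thesis .
qed

text \<open>The kernel is a Bochner integral in t, with value 0 where that integral diverges,
  whereas the iterated integral was computed with nonnegative integrals. The two agree for almost
  every y because the iterated integral is finite.\<close>

lemma nn_integral_G_kernel:
  assumes "0 < \<alpha>" "0 < x" "x < 1"
  shows "(\<integral>\<^sup>+y. ennreal (G_kernel \<alpha> x y) \<partial>unit_interval_measure)
    = ennreal ((x * (1 - x)) powr \<alpha> / Gamma (1 + 2 * \<alpha>))"
proof -
  define c where "c = x powr \<alpha> / (Gamma \<alpha>)\<^sup>2"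
  have c: "0 \<le> c" by (simp add: c_def)
  let ?H = "\<lambda>y t. indicator {0<..<1} y * y powr \<alpha> * G_integrand \<alpha> x y t"
  have [measurable]: "(\<lambda>(y, t). G_integrand \<alpha> x y t) \<in> borel_measurable (borel \<Otimes>\<^sub>M borel)"
    using measurable_Pair2[OF G_integrand_measurable, of x] by simp
  note I = nn_integral_G_integrand[OF assms]
  \<comment> \<open>This discards the points y with divergent t-integral, such as y = x when
    \<alpha> \<le> 1/2; at such points \<open>enn2real\<close> would turn infinity into 0.\<close>
  have "AE y in lborel. (\<integral>\<^sup>+t. ennreal (?H y t) \<partial>lborel) \<noteq> \<infinity>"
  proof (rule nn_integral_PInf_AE)
    show "(\<lambda>y. \<integral>\<^sup>+t. ennreal (?H y t) \<partial>lborel) \<in> borel_measurable lborel"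
      by measurable
  qed (simp add: I)
  then have "(\<integral>\<^sup>+y. ennreal (G_kernel \<alpha> x y) * indicator {0<..<1} y \<partial>lborel)
    = (\<integral>\<^sup>+y. ennreal c * (\<integral>\<^sup>+t. ennreal (?H y t) \<partial>lborel) \<partial>lborel)"
  proof (intro nn_integral_cong_AE, elim AE_mp, intro AE_I2 impI)
    fix y assume fin: "(\<integral>\<^sup>+t. ennreal (?H y t) \<partial>lborel) \<noteq> \<infinity>"
    have "(\<integral>t. ?H y t \<partial>lborel) = enn2real (\<integral>\<^sup>+t. ennreal (?H y t) \<partial>lborel)"
      by (rule integral_eq_nn_integral) (simp_all add: G_integrand_nonneg)
    then have "ennreal (\<integral>t. ?H y t \<partial>lborel) = (\<integral>\<^sup>+t. ennreal (?H y t) \<partial>lborel)"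
      using fin by (simp add: less_top)
    moreover have "indicator {0<..<1} y * G_kernel \<alpha> x y = c * (\<integral>t. ?H y t \<partial>lborel)"
      by (simp add: G_kernel_eq c_def)
    moreover have "ennreal (G_kernel \<alpha> x y) * indicator {0<..<1} y = ennreal (indicator {0<..<1} y * G_kernel \<alpha> x y)"
      by (simp add: indicator_def)
    ultimately show "ennreal (G_kernel \<alpha> x y) * indicator {0<..<1} y
      = ennreal c * (\<integral>\<^sup>+t. ennreal (?H y t) \<partial>lborel)"
      using c by (simp only: ennreal_mult')
  qed
  also have "\<dots> = ennreal (c * (Beta (\<alpha> + 1) \<alpha> * (1 - x) powr \<alpha> / \<alpha>))"
    by (subst nn_integral_cmult, measurable) (simp only: I ennreal_mult'[OF c])
  also have "c * (Beta (\<alpha> + 1) \<alpha> * (1 - x) powr \<alpha> / \<alpha>) = (x * (1 - x)) powr \<alpha> / Gamma (1 + 2 * \<alpha>)"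
  proof -
    have "\<alpha> \<notin> \<int>\<^sub>\<le>\<^sub>0" using assms by auto
    then have "Gamma (\<alpha> + 1) = \<alpha> * Gamma \<alpha>" by (rule Gamma_plus1)
    moreover have "Gamma \<alpha> \<noteq> 0" using less_imp_neq[OF Gamma_real_pos[OF assms(1)]] by simp
    moreover have "\<alpha> + 1 + \<alpha> = 1 + 2 * \<alpha>" by simp
    ultimately show ?thesis using assms
      by (simp add: c_def Beta_def power2_eq_square powr_mult add.commute)
  qed
  finally show ?thesis by (subst nn_integral_restrict_space) auto
qed

section \<open>The operator applied to the constant function 1\<close>

lemma measurable_unit_interval_pair:
  fixes K :: "real \<Rightarrow> real \<Rightarrow> real"
  assumes "case_prod K \<in> borel_measurable (borel \<Otimes>\<^sub>M borel)"
  shows "case_prod K \<in> borel_measurable (unit_interval_measure \<Otimes>\<^sub>M unit_interval_measure)"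
proof -
  have [measurable]: "(\<lambda>x. x) \<in> unit_interval_measure \<rightarrow>\<^sub>M borel"
    by (intro measurable_restrict_space1) simp
  have "(\<lambda>p. (fst p, snd p)) \<in> unit_interval_measure \<Otimes>\<^sub>M unit_interval_measure \<rightarrow>\<^sub>M borel \<Otimes>\<^sub>M borel"
    by (intro measurable_Pair measurable_compose[OF measurable_fst] measurable_compose[OF measurable_snd]) measurable
  from measurable_compose[OF this assms] show ?thesis by simp
qed

lemma G_operator_one:
  assumes "0 < \<alpha>" "0 < x" "x < 1"
  shows "G_operator \<alpha> (\<lambda>_. 1) x = (x * (1 - x)) powr \<alpha> / Gamma (1 + 2 * \<alpha>)"
proof -
  have [measurable]: "G_kernel \<alpha> x \<in> borel_measurable unit_interval_measure"
    using measurable_Pair2[OF measurable_unit_interval_pair[OF G_kernel_measurable], of x] assms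
    by (simp add: space_restrict_space)
  have "G_operator \<alpha> (\<lambda>_. 1) x = enn2real (\<integral>\<^sup>+y. ennreal (G_kernel \<alpha> x y) \<partial>unit_interval_measure)"
    unfolding integral_operator_def by (simp add: integral_eq_nn_integral G_kernel_nonneg)
  then show ?thesis using assms by (simp add: nn_integral_G_kernel)
qed

text \<open>Squaring doubles the exponents, so the integral is Beta(2\<alpha>+1, 2\<alpha>+1), whose
  numerator Gamma(1+2\<alpha>)^2 cancels the squared prefactor.\<close>

lemma L2_norm_G_operator_one:
  assumes "0 < \<alpha>"
  shows "L2_norm unit_interval_measure (G_operator \<alpha> (\<lambda>_. 1)) = 1 / sqrt (Gamma (4 * \<alpha> + 2))"
proof -
  let ?M = unit_interval_measure and ?g = "Gamma (1 + 2 * \<alpha>)"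
  have g: "0 < ?g" using assms by simp
  have [measurable]: "(\<lambda>x. x) \<in> ?M \<rightarrow>\<^sub>M borel"
    by (intro measurable_restrict_space1) simp
  have "(\<integral>x. (G_operator \<alpha> (\<lambda>_. 1) x)\<^sup>2 \<partial>?M) = (\<integral>x. ((x * (1 - x)) powr \<alpha> / ?g)\<^sup>2 \<partial>?M)"
    by (intro Bochner_Integration.integral_cong refl) (simp add: space_restrict_space G_operator_one assms)
  also have "\<dots> = enn2real (\<integral>\<^sup>+x. ennreal (((x * (1 - x)) powr \<alpha> / ?g)\<^sup>2) \<partial>?M)"
    by (rule integral_eq_nn_integral) auto
  also have "(\<integral>\<^sup>+x. ennreal (((x * (1 - x)) powr \<alpha> / ?g)\<^sup>2) \<partial>?M)
    = (\<integral>\<^sup>+x. ennreal (1 / ?g\<^sup>2) *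
        ennreal (indicator {0..1} x * (x powr (2 * \<alpha> + 1 - 1) * (1 - x) powr (2 * \<alpha> + 1 - 1))) \<partial>lborel)"
  proof (subst nn_integral_restrict_space, simp, intro nn_integral_cong)
    fix x :: real
    have "((x * (1 - x)) powr \<alpha> / ?g)\<^sup>2 * indicator {0<..<1} x
      = 1 / ?g\<^sup>2 * (indicator {0..1} x * (x powr (2 * \<alpha> + 1 - 1) * (1 - x) powr (2 * \<alpha> + 1 - 1)))"
    proof (cases "x = 0 \<or> x = 1")
      case False
      have "(z powr \<alpha>)\<^sup>2 = z powr (2 * \<alpha>)" for z :: real
        by (simp add: power2_eq_square flip: powr_add)
      then show ?thesis using False
        by (auto simp: indicator_def powr_mult power_divide power_mult_distrib)
    qed auto
    then show "ennreal (((x * (1 - x)) powr \<alpha> / ?g)\<^sup>2) * indicator {0<..<1} x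
      = ennreal (1 / ?g\<^sup>2) *
        ennreal (indicator {0..1} x * (x powr (2 * \<alpha> + 1 - 1) * (1 - x) powr (2 * \<alpha> + 1 - 1)))"
      by (metis ennreal_indicator ennreal_mult'' ennreal_mult' indicator_pos_le zero_le_divide_1_iff zero_le_power2)
  qed
  also have "\<dots> = ennreal (1 / ?g\<^sup>2) * ennreal (Beta (2 * \<alpha> + 1) (2 * \<alpha> + 1))"
    using nn_integral_Beta_scaled[of "2 * \<alpha> + 1" "2 * \<alpha> + 1" 1] assms
    by (subst nn_integral_cmult) auto
  also have "enn2real \<dots> = 1 / Gamma (4 * \<alpha> + 2)"
  proof -
    have "Beta (2 * \<alpha> + 1) (2 * \<alpha> + 1) = ?g\<^sup>2 / Gamma (4 * \<alpha> + 2)"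
      by (simp add: Beta_def power2_eq_square add.commute)
    then show ?thesis using less_imp_neq[OF g] assms by (simp flip: ennreal_mult)
  qed
  finally show ?thesis by (simp add: L2_norm_def real_sqrt_divide)
qed

section \<open>Inequalities for the Gamma function\<close>

text \<open>Both 1 + a and 1 - a are convex combinations of 1 + b and 1 - b, with the weights
  swapped. Adding the two log-convexity bounds makes the weights sum to 1 on each term.\<close>

lemma Gamma_symmetric_mono:
  fixes a b :: real
  assumes "0 \<le> a" "a \<le> b" "b < 1"
  shows "Gamma (1 + a) * Gamma (1 - a) \<le> Gamma (1 + b) * Gamma (1 - b)"
proof (cases "b = 0")
  case False
  then have b: "0 < b" using assms by simp
  \<comment> \<open>The solution of (1 - u)(1 + b) + u(1 - b) = 1 + a.\<close>
  define u where "u = (1 - a / b) / 2"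
  have u: "0 \<le> u" "u \<le> 1" using b assms by (auto simp: u_def field_simps)
  have "(1 - u) * (1 + b) + u * (1 - b) = 1 + a" "(1 - u) * (1 - b) + u * (1 + b) = 1 - a"
    using b by (auto simp: u_def field_simps)
  then have "ln (Gamma (1 + a)) \<le> (1 - u) * ln (Gamma (1 + b)) + u * ln (Gamma (1 - b))"
    "ln (Gamma (1 - a)) \<le> (1 - u) * ln (Gamma (1 - b)) + u * ln (Gamma (1 + b))"
    using convex_onD[OF log_convex_Gamma_real u, of "1 + b" "1 - b"]
      convex_onD[OF log_convex_Gamma_real u, of "1 - b" "1 + b"] assms b by auto
  then have "ln (Gamma (1 + a)) + ln (Gamma (1 - a)) \<le> ln (Gamma (1 + b)) + ln (Gamma (1 - b))"
    by (simp add: algebra_simps)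
  then have "ln (Gamma (1 + a) * Gamma (1 - a)) \<le> ln (Gamma (1 + b) * Gamma (1 - b))"
    using assms by (simp add: ln_mult_pos)
  then show ?thesis using assms by simp
qed (use assms in simp)

text \<open>On the positive axis Gamma has its minimum near 1.46, so it increases from 3/2
  on.\<close>

lemma Gamma_real_mono:
  fixes x y :: real
  assumes "3 / 2 \<le> x" "x \<le> y"
  shows "Gamma x \<le> Gamma y"
  using Gamma_real_strict_mono[of x y] assms by (cases "x = y") auto

text \<open>The number 4 separates the two sides. The left is at most sqrt(Gamma(4)) = sqrt 6. On
  the right, Gamma(2\<alpha>+4)/Gamma(1+2\<alpha>) is a cubic polynomial by the recurrence, and
  Gamma(\<alpha>) \<ge> 1/(\<alpha>(1+\<alpha>)) follows from Gamma(\<alpha>+2) \<ge> Gamma(2) =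
  1.\<close>

lemma sqrt_Gamma_le:
  assumes "0 < \<alpha>" "\<alpha> \<le> 1 / 2"
  shows "sqrt (Gamma (4 * \<alpha> + 2)) \<le> (Gamma \<alpha>)\<^sup>2 * Gamma (2 * \<alpha> + 4) / (6 * Gamma (1 + 2 * \<alpha>))"
proof -
  have Gamma_Suc: "Gamma (x + 1) = x * Gamma x" if "0 < x" for x :: real
    using that by (intro Gamma_plus1) auto
  have "Gamma (4 * \<alpha> + 2) \<le> Gamma 4"
    using assms by (intro Gamma_real_mono) auto
  also have "Gamma (4 :: real) = 6"
    using Gamma_fact[of 3, where ?'a = real] by (simp add: fact_numeral)
  finally have "sqrt (Gamma (4 * \<alpha> + 2)) \<le> sqrt (4\<^sup>2)"
    by (intro real_sqrt_le_mono) simp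
  then have upper: "sqrt (Gamma (4 * \<alpha> + 2)) \<le> 4" by simp
  have "Gamma (2 :: real) \<le> Gamma (\<alpha> + 1 + 1)"
    using assms by (intro Gamma_real_mono) auto
  also have "Gamma (\<alpha> + 1 + 1) = (1 + \<alpha>) * (\<alpha> * Gamma \<alpha>)"
    using assms by (simp only: Gamma_Suc) (simp add: Gamma_Suc add.commute)
  finally have "1 \<le> (1 + \<alpha>) * (\<alpha> * Gamma \<alpha>)"
    using Gamma_fact[of 1, where ?'a = real] by simp
  then have "1\<^sup>2 \<le> ((1 + \<alpha>) * (\<alpha> * Gamma \<alpha>))\<^sup>2"
    by (intro power_mono) auto
  then have 1: "1 \<le> (1 + \<alpha>)\<^sup>2 * \<alpha>\<^sup>2 * (Gamma \<alpha>)\<^sup>2"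
    by (simp add: power_mult_distrib mult.assoc)
  \<comment> \<open>The constant 24 is 4 * 6: the 4 comes from \<alpha>^2 \<le> 1/4, the 6 from
    comparing the cubic with 6(1+\<alpha>)^2. Dividing 24 by the 6 in the claim leaves the
    separating 4.\<close>
  have "(1 + \<alpha>)\<^sup>2 * \<alpha>\<^sup>2 \<le> (1 + \<alpha>)\<^sup>2 * (1 / 2)\<^sup>2"
    using assms by (intro mult_left_mono power_mono) auto
  also have "\<dots> \<le> (2 * \<alpha> + 3) * (2 * \<alpha> + 2) * (2 * \<alpha> + 1) / 24"
  proof -
    have "(1 + \<alpha>)\<^sup>2 * 6 \<le> (2 * \<alpha> + 3) * (2 * \<alpha> + 2) * (2 * \<alpha> + 1)"
    proof -
      \<comment> \<open>The common factor 1 + \<alpha> is divided out, using 2\<alpha> + 2 = 2(1 +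
        \<alpha>).\<close>
      have "(1 + \<alpha>) * 6 \<le> 2 * ((2 * \<alpha> + 3) * (2 * \<alpha> + 1))"
        using assms by (simp add: algebra_simps)
      from mult_left_mono[OF this, of "1 + \<alpha>"] show ?thesis
        using assms by (simp add: algebra_simps power2_eq_square)
    qed
    then show ?thesis by (simp add: power2_eq_square)
  qed
  finally have "(1 + \<alpha>)\<^sup>2 * \<alpha>\<^sup>2 * (Gamma \<alpha>)\<^sup>2
      \<le> (2 * \<alpha> + 3) * (2 * \<alpha> + 2) * (2 * \<alpha> + 1) / 24 * (Gamma \<alpha>)\<^sup>2"
    by (rule mult_right_mono) simp
  with 1 have 2: "4 \<le> (Gamma \<alpha>)\<^sup>2 * ((2 * \<alpha> + 3) * (2 * \<alpha> + 2) * (2 * \<alpha> + 1)) / 6"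
    by (simp add: mult_ac)
  have "Gamma (2 * \<alpha> + 4) = Gamma (1 + 2 * \<alpha> + 1 + 1 + 1)" by (simp add: add.commute)
  also have "\<dots> = (1 + 2 * \<alpha> + 1 + 1) * ((1 + 2 * \<alpha> + 1) * ((1 + 2 * \<alpha>) * Gamma (1 + 2 * \<alpha>)))"
    using assms by (simp only: Gamma_Suc)
  also have "\<dots> = (2 * \<alpha> + 3) * (2 * \<alpha> + 2) * (2 * \<alpha> + 1) * Gamma (1 + 2 * \<alpha>)"
    by (simp add: algebra_simps)
  finally have "(Gamma \<alpha>)\<^sup>2 * Gamma (2 * \<alpha> + 4) / (6 * Gamma (1 + 2 * \<alpha>))
      = (Gamma \<alpha>)\<^sup>2 * ((2 * \<alpha> + 3) * (2 * \<alpha> + 2) * (2 * \<alpha> + 1)) / 6"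
    using less_imp_neq[OF Gamma_real_pos[of "1 + 2 * \<alpha>"]] assms by simp
  with 2 upper show ?thesis by linarith
qed

(* rGamma is the reciprocal Gamma function 1 / Gamma, with rGamma 0 = 0. *)
theorem mainTheorem4:
  fixes \<alpha> :: real
  assumes "0 < \<alpha>" and "\<alpha> \<le> 1 / 2"
  shows "bounded_L2_integral_operator unit_interval_measure (G_kernel \<alpha>)
    \<and> 0 < L2_opnorm unit_interval_measure (G_operator \<alpha>)
    \<and> (Gamma \<alpha>)\<^sup>2 * Gamma (2 * \<alpha> + 4) / (6 * Gamma (1 + 2 * \<alpha>))
        \<ge> inverse (L2_opnorm unit_interval_measure (G_operator \<alpha>))
    \<and> inverse (L2_opnorm unit_interval_measure (G_operator \<alpha>))
        \<ge> Gamma (1 + \<alpha>) * Gamma (1 - \<alpha>) * rGamma (1 - 2 * \<alpha>)"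
proof -
  let ?M = unit_interval_measure and ?T = "G_operator \<alpha>"
  \<comment> \<open>The row integral (x(1-x))^\<alpha> / Gamma(1+2\<alpha>) with its numerator
    bounded by 1.\<close>
  define C where "C = 1 / Gamma (1 + 2 * \<alpha>)"
  have C: "0 < C" using assms by (simp add: C_def)
  have row: "(\<integral>\<^sup>+y. ennreal (G_kernel \<alpha> x y) \<partial>?M) \<le> ennreal C" if "x \<in> space ?M" for x
  proof -
    have x: "0 < x" "x < 1" using that by (auto simp: space_restrict_space)
    then have "(x * (1 - x)) powr \<alpha> \<le> 1"
      using assms by (intro powr_le1) (auto intro: mult_le_one)
    then have "(x * (1 - x)) powr \<alpha> / Gamma (1 + 2 * \<alpha>) \<le> C"
      using assms by (simp add: C_def divide_right_mono)
    then show ?thesis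
      using x assms C by (simp add: nn_integral_G_kernel)
  qed
  have column: "(\<integral>\<^sup>+x. ennreal (G_kernel \<alpha> x y) \<partial>?M) \<le> ennreal C" if "y \<in> space ?M" for y
    using row[OF that] by (simp only: G_kernel_commute[of \<alpha> _ y])
  have "sigma_finite_measure ?M"
    by (rule sigma_finite_measure_restrict_space) (auto intro: lborel.sigma_finite_measure_axioms)
  note schur = schur_test[OF this measurable_unit_interval_pair[OF G_kernel_measurable]
    G_kernel_nonneg less_imp_le[OF C] row column]
  have bounded: "bounded_L2_integral_operator ?M (G_kernel \<alpha>)"
    unfolding bounded_L2_integral_operator_def using schur by blast
  let ?S = "{L2_norm ?M (?T f) | f. f \<in> L2_space ?M \<and> L2_norm ?M f \<le> 1}"
  \<comment> \<open>The interval has measure 1, so the constant function 1 is an admissible test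
    function in the supremum.\<close>
  have one: "(\<lambda>_. 1) \<in> L2_space ?M" "L2_norm ?M (\<lambda>_. 1) = 1"
    by (auto simp: L2_space_def L2_norm_def emeasure_restrict_space space_restrict_space
      measure_restrict_space intro!: finite_measure.integrable_const finite_measureI)
  have le_C: "s \<le> C" if "s \<in> ?S" for s
  proof -
    from that obtain f where f: "s = L2_norm ?M (?T f)" "f \<in> L2_space ?M" "L2_norm ?M f \<le> 1"
      by blast
    have "s \<le> C * L2_norm ?M f" using schur(3)[of f] f by simp
    also have "\<dots> \<le> C * 1" using f(3) C by (intro mult_left_mono) auto
    finally show ?thesis by simp
  qed
  have mem: "L2_norm ?M (?T (\<lambda>_. 1)) \<in> ?S" using one by force
  \<comment> \<open>The supremum is taken in the reals: it dominates its elements because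
    \<open>C\<close> bounds the set, and below it is at most \<open>C\<close> because the set is
    nonempty.\<close>
  have "L2_norm ?M (?T (\<lambda>_. 1)) \<le> L2_opnorm ?M ?T"
    unfolding L2_opnorm_def by (intro cSup_upper[OF mem] bdd_aboveI[of _ C] le_C)
  then have lower: "1 / sqrt (Gamma (4 * \<alpha> + 2)) \<le> L2_opnorm ?M ?T"
    using assms by (simp add: L2_norm_G_operator_one)
  have sqrt_pos: "0 < sqrt (Gamma (4 * \<alpha> + 2))" using assms by simp
  have pos: "0 < L2_opnorm ?M ?T"
    using lower sqrt_pos by (smt (verit) divide_pos_pos)
  have upper: "L2_opnorm ?M ?T \<le> C"
    unfolding L2_opnorm_def using mem le_C by (intro cSup_least) auto
  have "inverse (L2_opnorm ?M ?T) \<le> inverse (1 / sqrt (Gamma (4 * \<alpha> + 2)))"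
    using lower sqrt_pos by (intro le_imp_inverse_le) auto
  also have "\<dots> \<le> (Gamma \<alpha>)\<^sup>2 * Gamma (2 * \<alpha> + 4) / (6 * Gamma (1 + 2 * \<alpha>))"
    using sqrt_Gamma_le[OF assms] by simp
  finally have first: "inverse (L2_opnorm ?M ?T) \<le> (Gamma \<alpha>)\<^sup>2 * Gamma (2 * \<alpha> + 4) / (6 * Gamma (1 + 2 * \<alpha>))" .
  \<comment> \<open>For \<alpha> < 1/2, multiplying by Gamma(1-2\<alpha>) > 0 turns this into the
    monotonicity of Gamma(1+a) Gamma(1-a) from a = \<alpha> to a = 2\<alpha> < 1. For \<alpha> = 1/2
    the left side is 0.\<close>
  have "Gamma (1 + \<alpha>) * Gamma (1 - \<alpha>) * rGamma (1 - 2 * \<alpha>) \<le> inverse C"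
  proof (cases "\<alpha> = 1 / 2")
    case True
    have "rGamma (1 - 2 * \<alpha>) = 0" unfolding True by simp
    then show ?thesis using C by simp
  next
    case False
    then have "0 < Gamma (1 - 2 * \<alpha>)" using assms by simp
    then show ?thesis
      using Gamma_symmetric_mono[of \<alpha> "2 * \<alpha>"] assms False
      by (simp add: C_def rGamma_inverse_Gamma field_simps)
  qed
  also have "\<dots> \<le> inverse (L2_opnorm ?M ?T)"
    using upper pos by (rule le_imp_inverse_le)
  finally show ?thesis using bounded pos first by blast
qed

end
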